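(* Let $X$ be a Banach space, $A$ the infinitesimal generator of a $C_0$-semigroup $(S_t)_{t\ge 0}$ on $X$ which is pseudo-contractive, i.e. there is $\beta\in\mathbb{R}$ with $\|S_t\|\le e^{\beta t}$ for all $t\ge 0$. Let $\alpha:X\to X$ be Lipschitz continuous with Lipschitz constant $L\ge 0$, and let $K\subset X$ be a nonempty closed subset. Then for each $\epsilon\ge 0$ the following statements are equivalent: (i) $\liminf_{t\downarrow 0}\frac1t d_K(S_t x+t\alpha(x))\le \epsilon$ for all $x\in K$. (ii) $d_K(\xi(t;x))\le e^{(\beta+L)t}d_K(x)+\varphi_{\beta+L}(t)\,\epsilon$ for all $(t,x)\in\mathbb{R}_+\times X$. (iii) There exists $\delta>0$ such that $d_K(\xi(t;x))\le \varphi_{\beta+L}(t)\,\epsilon$ for all $(t,x)\in[0,\delta]\times K$. Furthermore: (1) If $K\subset\mathcal{D}(A)$, then the equivalent statements (i), (ii), (iii) are satisfied if and only if $\liminf_{t\downarrow 0}\frac1t d_K\big(x+t(Ax+\alpha(x))\big)\le\epsilon$ for all $x\in K$. (2) If the equivalent statements (i), (ii), (iii) are fulfilled, and if there is a constant $B\in\mathbb{R}_+$ such that $\|\alpha(x)\|\le B$ for all $x\in X$, then $$d_K(\xi(t;x))\le e^{\beta t}d_K(x)+\varphi_\beta(t)(\epsilon+2B),\quad (t,x)\in\mathbb{R}_+\times X.$$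
   Context: $\mathbb{R}_+=[0,\infty)$; $\mathcal{D}(A)$ is the domain of $A$. $d_K(x):=\inf_{y\in K}\|x-y\|$. For $x\in X$, $\xi(\cdot;x):\mathbb{R}_+\to X$ is the unique mild solution of $\dot\xi(t)=A\xi(t)+\alpha(\xi(t))$, $\xi(0)=x$, i.e. the unique continuous function with $\xi(t;x)=S_t x+\int_0^t S_{t-s}\alpha(\xi(s;x))\,ds$ for all $t\in\mathbb{R}_+$. For $\gamma\in\mathbb{R}$, $\varphi_\gamma(t):=\int_0^t e^{\gamma(t-s)}\,ds$, $t\in\mathbb{R}_+$. Lipschitz constant $L$ means $\|\alpha(x)-\alpha(y)\|\le L\|x-y\|$ for all $x,y\in X$. *)

theory Defs
  imports "HOL-Analysis.Analysis"
begin

text \<open>Only the values \<^term>\<open>S t\<close> with \<^prop>\<open>t \<ge> (0::real)\<close> are constrained;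
  the values at negative times are irrelevant.\<close>

definition C0_semigroup :: "(real \<Rightarrow> 'a::real_normed_vector \<Rightarrow>\<^sub>L 'a) \<Rightarrow> bool" where
  "C0_semigroup S \<longleftrightarrow>
     S 0 = id_blinfun \<and>
     (\<forall>s\<ge>0. \<forall>t\<ge>0. S (s + t) = S s o\<^sub>L S t) \<and>
     (\<forall>x. ((\<lambda>t. blinfun_apply (S t) x) \<longlongrightarrow> x) (at_right 0))"

definition generator_domain :: "(real \<Rightarrow> 'a::real_normed_vector \<Rightarrow>\<^sub>L 'a) \<Rightarrow> 'a set" where
  "generator_domain S =
     {x. \<exists>y. ((\<lambda>h. (blinfun_apply (S h) x - x) /\<^sub>R h) \<longlongrightarrow> y) (at_right 0)}"

text \<open>The infinitesimal generator; its values are meaningful only on \<^term>\<open>generator_domain S\<close>.\<close>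

definition generator :: "(real \<Rightarrow> 'a::real_normed_vector \<Rightarrow>\<^sub>L 'a) \<Rightarrow> 'a \<Rightarrow> 'a" where
  "generator S x = Lim (at_right 0) (\<lambda>h. (blinfun_apply (S h) x - x) /\<^sub>R h)"

text \<open>Mild solutions on \<open>[0,\<infinity>)\<close> of the evolution equation with generator of \<open>S\<close>, nonlinearity
  \<open>\<alpha>\<close> and initial value \<open>x\<close>.  The integrand is continuous when \<open>S\<close> is a strongly continuous
  semigroup and \<open>\<alpha>\<close> is continuous, so the integral is an ordinary Riemann integral.\<close>

definition mild_solution ::
  "(real \<Rightarrow> 'a::banach \<Rightarrow>\<^sub>L 'a) \<Rightarrow> ('a \<Rightarrow> 'a) \<Rightarrow> 'a \<Rightarrow> (real \<Rightarrow> 'a) \<Rightarrow> bool" where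
  "mild_solution S \<alpha> x \<xi> \<longleftrightarrow>
     continuous_on {0..} \<xi> \<and>
     (\<forall>t\<ge>0. \<xi> t = blinfun_apply (S t) x
                  + integral {0..t} (\<lambda>s. blinfun_apply (S (t - s)) (\<alpha> (\<xi> s))))"

definition phi :: "real \<Rightarrow> real \<Rightarrow> real" where
  "phi \<gamma> t = integral {0..t} (\<lambda>s. exp (\<gamma> * (t - s)))"

end

theory Submission
  imports Defs
begin

text \<open>Mild solutions form a semiflow \<open>\<xi>\<close> with Lipschitz constants \<open>e\<^sup>\<omega>\<^sup>t\<close>, \<open>\<omega> = \<beta> + L\<close>, and
  \<open>\<xi>(t;x) = S\<^sub>t x + t \<alpha>(x) + o(t)\<close>, so (i) says that \<open>\<xi>\<close> leaves \<open>K\<close> with lower speed at most \<open>\<epsilon>\<close>.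
  Points of \<open>X\<close> need not have nearest points in \<open>K\<close>, so differentiating \<open>d\<^sub>K(\<xi>(t;x))\<close> along a solution
  does not work.  Instead, for \<open>c > \<epsilon>\<close>, order the pairs \<open>(t, y) \<in> [0,T] \<times> K\<close> by
  \<open>(s, y) \<preceq> (t, z)\<close> iff \<open>s \<le> t\<close> and \<open>dist z (\<xi>(t - s; y)) \<le> c \<phi>\<^sub>\<omega>(t - s)\<close>; this is transitive because
  \<open>\<phi>\<^sub>\<omega>(s + t) = \<phi>\<^sub>\<omega>(s) + e\<^sup>\<omega>\<^sup>s \<phi>\<^sub>\<omega>(t)\<close>.  Increasing sequences have upper bounds, tangency lets every
  pair with \<open>t < T\<close> advance, and a pair above \<open>(0, x)\<close> with \<open>t = T\<close> shows
  \<open>d\<^sub>K(\<xi>(T;x)) \<le> c \<phi>\<^sub>\<omega>(T)\<close> for \<open>x \<in> K\<close>.  The Lipschitz bound then extends this to all \<open>x\<close>.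
  Part (2) is the same result for \<open>S\<close> itself, with \<open>\<epsilon> + B\<close> in place of \<open>\<epsilon>\<close>, together with
  \<open>dist (\<xi>(t;x)) (S\<^sub>t x) \<le> \<phi>\<^sub>\<beta>(t) B\<close>.\<close>

section \<open>The weight function \<open>phi\<close>\<close>

lemma phi_closed_form:
  assumes "t \<ge> 0"
  shows "phi \<gamma> t = (if \<gamma> = 0 then t else (exp (\<gamma> * t) - 1) / \<gamma>)"
proof (cases "\<gamma> = 0")
  case True
  then show ?thesis using assms by (simp add: phi_def)
next
  case False
  have "((\<lambda>s. exp (\<gamma> * (t - s))) has_integral (- exp (\<gamma> * (t - t)) / \<gamma> - (- exp (\<gamma> * (t - 0)) / \<gamma>))) {0..t}"
    using assms False
    by (intro fundamental_theorem_of_calculus)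
      (auto intro!: derivative_eq_intros simp flip: has_real_derivative_iff_has_vector_derivative)
  then show ?thesis
    using False by (simp add: phi_def integral_unique diff_divide_distrib)
qed

lemma phi_0 [simp]: "phi \<gamma> 0 = 0"
  by (simp add: phi_def)

lemma phi_add:
  assumes "s \<ge> 0" "t \<ge> 0"
  shows "phi \<gamma> (s + t) = phi \<gamma> s + exp (\<gamma> * s) * phi \<gamma> t"
  using assms by (auto simp: phi_closed_form field_simps exp_add)

lemma continuous_on_phi: "continuous_on {0..} (phi \<gamma>)"
proof -
  have "continuous_on {0..} (\<lambda>t. if \<gamma> = 0 then t else (exp (\<gamma> * t) - 1) / \<gamma>)"
    by (cases "\<gamma> = 0") (auto intro!: continuous_intros)
  then show ?thesis
    by (rule continuous_on_eq) (simp add: phi_closed_form)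
qed

text \<open>The limit is the derivative of \<open>phi \<gamma>\<close> at \<open>0\<close>. It lets
  the rates \<open>c * h\<close> and \<open>c * phi \<gamma> h\<close> replace each other for small
  \<open>h\<close>, at the cost of an arbitrarily small change of \<open>c\<close>.\<close>

lemma phi_over_t_tendsto: "((\<lambda>t. phi \<gamma> t / t) \<longlongrightarrow> 1) (at_right 0)"
proof (cases "\<gamma> = 0")
  case True
  have "eventually (\<lambda>t. 1 = phi \<gamma> t / t) (at_right 0)"
    using True by (auto simp: phi_closed_form eventually_at_right_less intro: eventually_mono[OF eventually_at_right_less])
  then show ?thesis by (rule Lim_transform_eventually[rotated]) simp
next
  case False
  have "((\<lambda>t. (exp (\<gamma> * t) - 1) / \<gamma>) has_field_derivative 1) (at 0)"
    using False by (auto intro!: derivative_eq_intros)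
  then have "((\<lambda>t. (exp (\<gamma> * t) - 1) / \<gamma> / t) \<longlongrightarrow> 1) (at 0)"
    by (simp add: has_field_derivative_iff)
  then have "((\<lambda>t. (exp (\<gamma> * t) - 1) / \<gamma> / t) \<longlongrightarrow> 1) (at_right 0)"
    by (rule filterlim_at_split[THEN iffD1, THEN conjunct2])
  moreover have "eventually (\<lambda>t. (exp (\<gamma> * t) - 1) / \<gamma> / t = phi \<gamma> t / t) (at_right 0)"
    using False by (auto simp: phi_closed_form intro: eventually_mono[OF eventually_at_right_less])
  ultimately show ?thesis by (rule Lim_transform_eventually)
qed

text \<open>The Brezis--Browder ordering principle: choose each successor to climb at least half of the
  remaining height.\<close>

lemma brezis_browder:
  fixes f :: "'p \<Rightarrow> real"
  assumes "p \<in> P"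
    and refl: "\<And>p. p \<in> P \<Longrightarrow> R p p"
    and trans: "\<And>p q r. \<lbrakk>p \<in> P; q \<in> P; r \<in> P; R p q; R q r\<rbrakk> \<Longrightarrow> R p r"
    and mono: "\<And>p q. R p q \<Longrightarrow> f p \<le> f q"
    and bound: "\<And>p. p \<in> P \<Longrightarrow> f p \<le> b"
    and chain: "\<And>c :: nat \<Rightarrow> 'p. \<lbrakk>\<And>n. c n \<in> P; \<And>m n. m \<le> n \<Longrightarrow> R (c m) (c n)\<rbrakk>
                  \<Longrightarrow> \<exists>q\<in>P. \<forall>n. R (c n) q"
    and step: "\<And>p. \<lbrakk>p \<in> P; f p < b\<rbrakk> \<Longrightarrow> \<exists>q\<in>P. R p q \<and> f p < f q"
  shows "\<exists>q\<in>P. R p q \<and> f q = b"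
proof -
  \<comment> \<open>Supremum of the heights reachable from \<open>p\<close>; it need not be
    attained.\<close>
  define \<sigma> where "\<sigma> p = Sup (f ` {q \<in> P. R p q})" for p
  have bdd: "bdd_above (f ` {q \<in> P. R p q})" for p
    using bound by (auto intro!: bdd_aboveI[of _ b])
  have \<sigma>_ge: "f q \<le> \<sigma> p" if "q \<in> P" "R p q" for p q
    unfolding \<sigma>_def using bdd that by (intro cSup_upper) auto
  have "\<exists>q\<in>P. R p q \<and> (f p + \<sigma> p) / 2 \<le> f q" if p: "p \<in> P" for p
  proof (cases "f p < \<sigma> p")
    case True
    then have "(f p + \<sigma> p) / 2 < \<sigma> p" by simp
    then obtain y where "y \<in> f ` {q \<in> P. R p q}" "(f p + \<sigma> p) / 2 < y"
      unfolding \<sigma>_def using p refl less_cSupD[of "f ` {q \<in> P. R p q}"] by blast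
    then show ?thesis by force
  next
    case False
    then show ?thesis using p refl by (intro bexI[of _ p]) auto
  qed
  then obtain nxt where nxt: "\<And>p. p \<in> P \<Longrightarrow> nxt p \<in> P \<and> R p (nxt p) \<and> (f p + \<sigma> p) / 2 \<le> f (nxt p)"
    by metis
  define c where "c n = (nxt ^^ n) p" for n
  have cP: "c n \<in> P" for n
    by (induction n) (use \<open>p \<in> P\<close> nxt in \<open>auto simp: c_def\<close>)
  have cS: "R (c n) (c (Suc n))" "(f (c n) + \<sigma> (c n)) / 2 \<le> f (c (Suc n))" for n
    using nxt[OF cP[of n]] by (auto simp: c_def)
  have cR: "R (c m) (c n)" if "m \<le> n" for m n
    using that by (induction rule: dec_induct) (use cP cS refl trans in blast)+
  obtain q where q: "q \<in> P" "\<And>n. R (c n) q"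
    using chain[of c] cP cR by blast
  have "f q = b"
  proof (rule ccontr)
    assume "f q \<noteq> b"
    then obtain q' where q': "q' \<in> P" "R q q'" "f q < f q'"
      using step[of q] q bound[of q] by force
    have "incseq (\<lambda>n. f (c n))"
      using cS mono by (intro incseq_SucI) blast
    then obtain l where l: "(\<lambda>n. f (c n)) \<longlonglongrightarrow> l"
      using incseq_convergent[of "\<lambda>n. f (c n)" b] bound cP by blast
    \<comment> \<open>By transitivity \<open>q'\<close> lies above every \<open>c n\<close>, so each
      step climbs at least half way to \<open>f q'\<close>. In the limit this forces
      \<open>f q' \<le> l \<le> f q\<close>, against the choice of \<open>q'\<close>.\<close>
    have half: "(f (c n) + f q') / 2 \<le> f (c (Suc n))" for n
      using \<sigma>_ge[of q' "c n"] q' q trans[OF cP q(1) q'(1) q(2) q'(2), of n] cS(2)[of n] by simp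
    have "(\<lambda>n. (f (c n) + f q') / 2) \<longlonglongrightarrow> (l + f q') / 2"
      by (intro tendsto_intros l) simp
    then have "(l + f q') / 2 \<le> l"
      using LIMSEQ_Suc[OF l] by (rule LIMSEQ_le) (use half in blast)
    moreover have "l \<le> f q"
      using l by (rule LIMSEQ_le_const2) (use q mono in blast)
    ultimately show False using q' by simp
  qed
  moreover have "R p q" using q(2)[of 0] by (simp add: c_def)
  ultimately show ?thesis using q by blast
qed

section \<open>Distance to a closed set along a Lipschitz semiflow\<close>

text \<open>Stated abstractly so that one estimate covers both the mild solutions, with rate
  \<open>\<beta> + L\<close>, and the semigroup itself, with rate \<open>\<beta>\<close>.\<close>

locale lipschitz_semiflow =
  fixes \<Phi> :: "real \<Rightarrow> 'a::complete_space \<Rightarrow> 'a" and \<omega> :: real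
  assumes flow_0: "\<Phi> 0 x = x"
    and flow_add: "\<lbrakk>s \<ge> 0; t \<ge> 0\<rbrakk> \<Longrightarrow> \<Phi> (s + t) x = \<Phi> s (\<Phi> t x)"
    and flow_continuous: "continuous_on {0..} (\<lambda>t. \<Phi> t x)"
    and flow_lipschitz: "t \<ge> 0 \<Longrightarrow> dist (\<Phi> t x) (\<Phi> t y) \<le> exp (\<omega> * t) * dist x y"
begin

text \<open>Supplies the upper bounds of increasing sequences. The times rise to a limit
  \<open>s\<close>; from a late stage on little time remains, so the flow and the allowed error
  confine the points and make them Cauchy. The relation then passes to the limit.\<close>

lemma chain_bound:
  fixes c :: real and t :: "nat \<Rightarrow> real" and y :: "nat \<Rightarrow> 'a"
  assumes "closed K" and yK: "\<And>n. y n \<in> K" and t: "\<And>n. t n \<in> {0..T}"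
    and rel: "\<And>m n. m \<le> n \<Longrightarrow> t m \<le> t n \<and> dist (y n) (\<Phi> (t n - t m) (y m)) \<le> c * phi \<omega> (t n - t m)"
  obtains s z where "s \<in> {0..T}" "z \<in> K"
    "\<And>n. t n \<le> s \<and> dist z (\<Phi> (s - t n) (y n)) \<le> c * phi \<omega> (s - t n)"
proof -
  have "incseq t" using rel by (simp add: incseq_def)
  then obtain s where s: "t \<longlonglongrightarrow> s" "\<And>n. t n \<le> s"
    using incseq_convergent[of t T] t by auto
  have sT: "s \<in> {0..T}"
    using closed_sequentially[of "{0..T}" t s] s t by auto
  \<comment> \<open>Continuity is available on \<open>{0..}\<close> only; \<open>t n - t m\<close>
    lies there as soon as \<open>n \<ge> m\<close>.\<close>
  have flow_lim: "(\<lambda>n. \<Phi> (t n - t m) (y m)) \<longlonglongrightarrow> \<Phi> (s - t m) (y m)"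
    and phi_lim: "(\<lambda>n. c * phi \<omega> (t n - t m)) \<longlonglongrightarrow> c * phi \<omega> (s - t m)" for m
    using s rel
    by (intro tendsto_intros continuous_on_tendsto_compose[OF flow_continuous]
        continuous_on_tendsto_compose[OF continuous_on_phi];
      force simp: eventually_sequentially)+
  have "(\<lambda>m. c * phi \<omega> (s - t m)) \<longlonglongrightarrow> c * phi \<omega> (s - s)"
    using s by (intro tendsto_intros continuous_on_tendsto_compose[OF continuous_on_phi]) auto
  then have phi_0_lim: "(\<lambda>m. c * phi \<omega> (s - t m)) \<longlonglongrightarrow> 0" by simp
  have "Cauchy y"
  proof (rule metric_CauchyI)
    fix e :: real assume e: "e > 0"
    then obtain m where m: "c * phi \<omega> (s - t m) < e / 4"
      using order_tendstoD(2)[OF phi_0_lim, of "e / 4"] by (auto simp: eventually_sequentially)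
    \<comment> \<open>All late points lie within \<open>e / 2\<close> of \<open>w\<close>: one
      quarter of \<open>e\<close> for the error allowed since stage \<open>m\<close>, one for the
      convergence of the flow from \<open>y m\<close>.\<close>
    define w where "w = \<Phi> (s - t m) (y m)"
    have "\<forall>\<^sub>F n in sequentially. c * phi \<omega> (t n - t m) < e / 4"
      using order_tendstoD(2)[OF phi_lim m] .
    moreover have "\<forall>\<^sub>F n in sequentially. dist (\<Phi> (t n - t m) (y m)) w < e / 4"
      unfolding w_def using tendstoD[OF flow_lim, of "e / 4" m] e by simp
    moreover have "\<forall>\<^sub>F n in sequentially. n \<ge> m" by (rule eventually_ge_at_top)
    ultimately have "\<forall>\<^sub>F n in sequentially. dist (y n) w < e / 2"
    proof eventually_elim
      case (elim n)
      then show ?case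
        using rel[of m n] dist_triangle[of "y n" w "\<Phi> (t n - t m) (y m)"] by linarith
    qed
    then obtain N where "\<And>n. n \<ge> N \<Longrightarrow> dist (y n) w < e / 2"
      by (auto simp: eventually_sequentially)
    then show "\<exists>M. \<forall>m\<ge>M. \<forall>n\<ge>M. dist (y m) (y n) < e"
      using dist_triangle_half_l by blast
  qed
  then obtain z where z: "y \<longlonglongrightarrow> z"
    using Cauchy_convergent convergent_def by blast
  have "dist z (\<Phi> (s - t m) (y m)) \<le> c * phi \<omega> (s - t m)" for m
    using rel by (intro LIMSEQ_le[OF tendsto_dist[OF z flow_lim] phi_lim]) blast
  moreover have "z \<in> K"
    using closed_sequentially[OF \<open>closed K\<close> _ z] yK by blast
  ultimately show ?thesis using that s sT by blast
qed

text \<open>The ordering principle with time as height and \<open>T\<close> as its bound. The gap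
  between \<open>\<epsilon>\<close> and \<open>c\<close> is the slack that makes single steps
  possible without nearest points.\<close>

lemma approximate_trajectory:
  assumes "closed K" "x \<in> K" "T \<ge> 0" "c > \<epsilon>"
    and tangent: "\<And>y c. \<lbrakk>y \<in> K; c > \<epsilon>\<rbrakk> \<Longrightarrow> \<exists>\<^sub>F h in at_right 0. infdist (\<Phi> h y) K < c * h"
  shows "infdist (\<Phi> T x) K \<le> c * phi \<omega> T"
proof -
  define P where "P = {0..T} \<times> K"
  define R where "R p q \<longleftrightarrow> fst p \<le> fst q \<and>
    dist (snd q) (\<Phi> (fst q - fst p) (snd p)) \<le> c * phi \<omega> (fst q - fst p)" for p q :: "real \<times> 'a"
  have "\<exists>q\<in>P. R (0, x) q \<and> fst q = T"
  proof (rule brezis_browder)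
    show "(0, x) \<in> P" using assms by (simp add: P_def)
    show "R p p" for p by (simp add: R_def flow_0)
    show "fst p \<le> fst q" if "R p q" for p q using that by (simp add: R_def)
    show "fst p \<le> T" if "p \<in> P" for p using that by (auto simp: P_def)
  next
    fix p q r assume pqr: "R p q" "R q r"
    define a b where "a = fst q - fst p" and "b = fst r - fst q"
    have ab: "a \<ge> 0" "b \<ge> 0" "fst r - fst p = b + a"
      using pqr by (auto simp: R_def a_def b_def)
    have "dist (snd r) (\<Phi> (b + a) (snd p))
        \<le> dist (snd r) (\<Phi> b (snd q)) + dist (\<Phi> b (snd q)) (\<Phi> b (\<Phi> a (snd p)))"
      using ab by (simp add: flow_add dist_triangle)
    also have "\<dots> \<le> c * phi \<omega> b + exp (\<omega> * b) * dist (snd q) (\<Phi> a (snd p))"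
      using pqr flow_lipschitz[OF ab(2)] by (auto simp: R_def b_def intro: add_mono)
    also have "\<dots> \<le> c * phi \<omega> b + exp (\<omega> * b) * (c * phi \<omega> a)"
      using pqr by (auto simp: R_def a_def)
    also have "\<dots> = c * phi \<omega> (b + a)"
      unfolding phi_add[OF ab(2,1)] by (simp add: algebra_simps)
    finally show "R p r" using pqr ab by (auto simp: R_def)
  next
    fix u :: "nat \<Rightarrow> real \<times> 'a"
    assume u: "\<And>n. u n \<in> P" "\<And>m n. m \<le> n \<Longrightarrow> R (u m) (u n)"
    obtain s z where "s \<in> {0..T}" "z \<in> K"
      "\<And>n. fst (u n) \<le> s \<and> dist z (\<Phi> (s - fst (u n)) (snd (u n))) \<le> c * phi \<omega> (s - fst (u n))"
    proof (rule chain_bound[of K "\<lambda>n. snd (u n)" "\<lambda>n. fst (u n)" T c])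
      show "snd (u n) \<in> K" "fst (u n) \<in> {0..T}" for n
        using u(1)[of n] by (auto simp: P_def)
    qed (use assms u(2) in \<open>auto simp: R_def\<close>)
    then show "\<exists>q\<in>P. \<forall>n. R (u n) q"
      by (intro bexI[of _ "(s, z)"]) (auto simp: R_def P_def)
  next
    fix p assume p: "p \<in> P" "fst p < T"
    define t y where "t = fst p" and "y = snd p"
    have ty: "t \<ge> 0" "t < T" "y \<in> K" using p by (auto simp: P_def t_def y_def)
    \<comment> \<open>A rate strictly between \<open>\<epsilon>\<close> and \<open>c\<close>:
      tangency is used with \<open>d\<close>, and the limit of \<open>phi \<omega> h / h\<close>
      gives \<open>d * h < c * phi \<omega> h\<close> for small \<open>h\<close>.\<close>
    define d where "d = (\<epsilon> + c) / 2"
    have d: "\<epsilon> < d" "d < c" using assms by (auto simp: d_def)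
    have "((\<lambda>h. c * (phi \<omega> h / h)) \<longlongrightarrow> c * 1) (at_right 0)"
      by (intro tendsto_intros phi_over_t_tendsto)
    then have "\<forall>\<^sub>F h in at_right 0. d < c * (phi \<omega> h / h)"
      using order_tendstoD(1)[of _ "c * 1" "at_right 0" d] d by simp
    moreover have "\<forall>\<^sub>F h in at_right 0. h \<in> {0<..<T - t}"
      using ty by (intro eventually_at_right_real) simp
    ultimately have ev: "\<forall>\<^sub>F h in at_right 0. d * h < c * phi \<omega> h \<and> 0 < h \<and> h < T - t"
      by eventually_elim (auto simp: field_simps)
    \<comment> \<open>Tangency holds for arbitrarily small \<open>h\<close>, perhaps not for all
      small ones; \<open>ev\<close> holds for all small \<open>h\<close>, so some \<open>h\<close>
      satisfies both.\<close>
    obtain h where h: "infdist (\<Phi> h y) K < c * phi \<omega> h" "0 < h" "h < T - t"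
      using frequently_eventually_frequently[OF tangent[OF ty(3) d(1)] ev, THEN frequently_ex]
      by (meson order_less_trans)
    \<comment> \<open>Strictness yields a point of \<open>K\<close> even if the infimum is not
      attained.\<close>
    obtain z where z: "z \<in> K" "dist (\<Phi> h y) z < c * phi \<omega> h"
      using h(1) ty(3) cInf_lessD[of "dist (\<Phi> h y) ` K" "c * phi \<omega> h"]
      by (auto simp: infdist_def split: if_splits)
    show "\<exists>q\<in>P. R p q \<and> fst p < fst q"
      using z h ty
      by (intro bexI[of _ "(t + h, z)"]) (auto simp: R_def P_def t_def y_def dist_commute)
  qed
  then obtain z where "z \<in> K" "dist z (\<Phi> T x) \<le> c * phi \<omega> T"
    by (auto simp: R_def P_def)
  then show ?thesis by (simp add: infdist_le2 dist_commute)
qed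

theorem infdist_flow_le:
  assumes K: "closed K" "K \<noteq> {}" and "t \<ge> 0"
    and tangent: "\<And>y c. \<lbrakk>y \<in> K; c > \<epsilon>\<rbrakk> \<Longrightarrow> \<exists>\<^sub>F h in at_right 0. infdist (\<Phi> h y) K < c * h"
  shows "infdist (\<Phi> t x) K \<le> exp (\<omega> * t) * infdist x K + phi \<omega> t * \<epsilon>"
proof -
  \<comment> \<open>Let \<open>c\<close> decrease to \<open>\<epsilon>\<close> in
    \<open>approximate_trajectory\<close>.\<close>
  have inK: "infdist (\<Phi> t y) K \<le> phi \<omega> t * \<epsilon>" if y: "y \<in> K" for y
  proof (rule tendsto_lowerbound[where f = "\<lambda>c. c * phi \<omega> t" and F = "at_right \<epsilon>"])
    show "((\<lambda>c. c * phi \<omega> t) \<longlongrightarrow> phi \<omega> t * \<epsilon>) (at_right \<epsilon>)"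
      by (auto intro!: tendsto_eq_intros)
    show "\<forall>\<^sub>F c in at_right \<epsilon>. infdist (\<Phi> t y) K \<le> c * phi \<omega> t"
      using eventually_at_right_less[of \<epsilon>]
      by eventually_elim (use approximate_trajectory[OF K(1) y] assms in blast)
  qed simp
  have "infdist (\<Phi> t x) K - phi \<omega> t * \<epsilon> \<le> exp (\<omega> * t) * dist x y" if y: "y \<in> K" for y
    using infdist_triangle[of "\<Phi> t x" K "\<Phi> t y"] inK[OF y] flow_lipschitz[OF \<open>t \<ge> 0\<close>, of x y]
    by linarith
  \<comment> \<open>Once the left side is free of \<open>y\<close>, the bound passes to the infimum
    of \<open>dist x y\<close> over \<open>K\<close>.\<close>
  then have "(infdist (\<Phi> t x) K - phi \<omega> t * \<epsilon>) / exp (\<omega> * t) \<le> infdist x K"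
    unfolding infdist_notempty[OF K(2)]
    by (intro cINF_greatest K) (simp add: field_simps)
  then show ?thesis by (simp add: field_simps)
qed

end

section \<open>Gronwall's inequality and lower limits of distance quotients\<close>

text \<open>The right-hand side \<open>V\<close> has derivative \<open>L * u \<le> L * V\<close>, so
  \<open>exp (- L * t) * V t\<close> does not increase; integrating its derivative compares the
  values at \<open>0\<close> and \<open>T\<close>.\<close>

lemma gronwall:
  fixes u :: "real \<Rightarrow> real"
  assumes cont: "continuous_on {0..T} u" and "T \<ge> 0" "L \<ge> 0"
    and le: "\<And>t. t \<in> {0..T} \<Longrightarrow> u t \<le> a + L * integral {0..t} u"
  shows "u T \<le> a * exp (L * T)"
proof -
  define V where "V t = a + L * integral {0..t} u" for t
  have "((\<lambda>t. exp (- L * t) * V t) has_real_derivative exp (- L * t) * L * (u t - V t))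
      (at t within {0..T})" if "t \<in> {0..T}" for t
    unfolding V_def
    by (rule derivative_eq_intros integral_has_real_derivative[OF cont that] refl)+
      (simp add: algebra_simps)
  then have "((\<lambda>t. exp (- L * t) * L * (u t - V t)) has_integral
      exp (- L * T) * V T - exp (- L * 0) * V 0) {0..T}"
    using \<open>T \<ge> 0\<close>
    by (intro fundamental_theorem_of_calculus)
      (auto simp flip: has_real_derivative_iff_has_vector_derivative)
  then have "exp (- L * T) * V T - exp (- L * 0) * V 0 \<le> 0"
    by (rule has_integral_le[OF _ has_integral_0])
      (use le \<open>L \<ge> 0\<close> in \<open>auto simp: V_def intro!: mult_nonneg_nonpos\<close>)
  then have "V T \<le> a * exp (L * T)"
    by (simp add: V_def exp_minus field_simps)
  moreover have "u T \<le> V T" using le \<open>T \<ge> 0\<close> by (simp add: V_def)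
  ultimately show ?thesis by simp
qed

text \<open>Trades the extended real lower limit for a condition without division. All
  \<open>c' > c\<close> occur because the quotients may approach \<open>c\<close> from
  above.\<close>

lemma Liminf_divide_le_iff:
  fixes d :: "real \<Rightarrow> real"
  shows "Liminf (at_right 0) (\<lambda>t. ereal (1 / t * d t)) \<le> ereal c \<longleftrightarrow>
    (\<forall>c'>c. \<exists>\<^sub>F t in at_right 0. d t < c' * t)" (is "?L \<le> _ \<longleftrightarrow> _")
proof
  assume le: "?L \<le> ereal c"
  show "\<forall>c'>c. \<exists>\<^sub>F t in at_right 0. d t < c' * t"
  proof (intro allI impI, rule ccontr)
    fix c' assume c': "c < c'" and "\<not> (\<exists>\<^sub>F t in at_right 0. d t < c' * t)"
    then have "\<forall>\<^sub>F t in at_right 0. \<not> d t < c' * t" by (simp add: not_frequently)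
    then have "\<forall>\<^sub>F t in at_right 0. ereal c' \<le> ereal (1 / t * d t)"
      using eventually_at_right_less[of 0] by eventually_elim (simp add: field_simps)
    then have "ereal c' \<le> ?L" by (rule Liminf_bounded)
    then have "ereal c' \<le> ereal c" using le by (rule order_trans)
    then show False using c' by simp
  qed
next
  assume freq: "\<forall>c'>c. \<exists>\<^sub>F t in at_right 0. d t < c' * t"
  show "?L \<le> ereal c"
  proof (rule ccontr)
    assume "\<not> ?L \<le> ereal c"
    then obtain c' where c': "ereal c < ereal c'" "ereal c' < ?L"
      using ereal_dense2 by (meson not_le)
    then have "\<forall>\<^sub>F t in at_right 0. ereal c' < ereal (1 / t * d t)"
      using le_Liminf_iff[THEN iffD1, OF order_refl] by blast
    then have "\<forall>\<^sub>F t in at_right 0. \<not> d t < c' * t"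
      using eventually_at_right_less[of 0]
      by eventually_elim (simp add: not_less pos_less_divide_eq less_imp_le)
    then show False using freq c' by (auto simp: frequently_def)
  qed
qed

lemma norm_divideR_less_iff:
  fixes v :: "'a::real_normed_vector"
  assumes "t > 0"
  shows "norm (v /\<^sub>R t) < e \<longleftrightarrow> norm v < e * t"
proof -
  have "norm (v /\<^sub>R t) = norm v / t" using assms by (simp add: divide_inverse mult.commute)
  then show ?thesis using assms by (simp add: pos_divide_less_eq)
qed

text \<open>\<open>infdist\<close> is 1-Lipschitz, so changing the curve by \<open>o(t)\<close>
  changes the distance by \<open>o(t)\<close>.\<close>

lemma frequently_infdist_less_transfer:
  fixes f g :: "real \<Rightarrow> 'a::real_normed_vector"
  assumes lim: "((\<lambda>t. (f t - g t) /\<^sub>R t) \<longlongrightarrow> 0) (at_right 0)"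
    and freq: "\<And>c. c > \<epsilon> \<Longrightarrow> \<exists>\<^sub>F t in at_right 0. infdist (f t) K < c * t" and "c > \<epsilon>"
  shows "\<exists>\<^sub>F t in at_right 0. infdist (g t) K < c * t"
proof -
  \<comment> \<open>Half of the gap: \<open>freq\<close> is used at \<open>c - \<eta>\<close>, and
    \<open>\<eta> * t\<close> pays for the change of curve.\<close>
  define \<eta> where "\<eta> = (c - \<epsilon>) / 2"
  have \<eta>: "\<eta> > 0" "c - \<eta> > \<epsilon>" using \<open>c > \<epsilon>\<close> by (auto simp: \<eta>_def field_simps)
  have "\<forall>\<^sub>F t in at_right 0. norm ((f t - g t) /\<^sub>R t) < \<eta>"
    using tendstoD[OF lim \<eta>(1)] by (simp add: dist_norm)
  then have "\<forall>\<^sub>F t in at_right 0. norm (f t - g t) < \<eta> * t"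
    using eventually_at_right_less[of 0] by eventually_elim (simp add: norm_divideR_less_iff del: norm_scaleR)
  then have "\<forall>\<^sub>F t in at_right 0. infdist (f t) K < (c - \<eta>) * t \<longrightarrow> infdist (g t) K < c * t"
  proof eventually_elim
    case (elim t)
    then show ?case
      using infdist_triangle[of "g t" K "f t"] by (auto simp: dist_norm norm_minus_commute algebra_simps)
  qed
  then show ?thesis using freq[OF \<eta>(2)] by (rule frequently_mp)
qed

text \<open>Serves to replace the curve in (i) by the mild solution, and on the domain of the
  generator by the first-order expression in (1).\<close>

lemma Liminf_infdist_transfer:
  fixes f g :: "real \<Rightarrow> 'a::real_normed_vector"
  assumes lim: "((\<lambda>t. (f t - g t) /\<^sub>R t) \<longlongrightarrow> 0) (at_right 0)"
  shows "Liminf (at_right 0) (\<lambda>t. ereal (1 / t * infdist (f t) K)) \<le> ereal \<epsilon> \<longleftrightarrow>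
    Liminf (at_right 0) (\<lambda>t. ereal (1 / t * infdist (g t) K)) \<le> ereal \<epsilon>"
proof -
  have "((\<lambda>t. (g t - f t) /\<^sub>R t) \<longlongrightarrow> 0) (at_right 0)"
    using tendsto_minus[OF lim] by (simp flip: scaleR_minus_right)
  then show ?thesis
    unfolding Liminf_divide_le_iff using frequently_infdist_less_transfer lim by blast
qed

section \<open>Pseudo-contractive semigroups\<close>

locale pseudo_contractive_semigroup =
  fixes S :: "real \<Rightarrow> 'a::banach \<Rightarrow>\<^sub>L 'a" and \<beta> :: real
  assumes semigroup: "C0_semigroup S"
    and pseudo_contractive: "t \<ge> 0 \<Longrightarrow> norm (S t) \<le> exp (\<beta> * t)"
begin

lemma S_0: "S 0 x = x"
  using semigroup by (simp add: C0_semigroup_def)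

lemma S_add: "\<lbrakk>s \<ge> 0; t \<ge> 0\<rbrakk> \<Longrightarrow> S (s + t) x = S s (S t x)"
  using semigroup by (simp add: C0_semigroup_def)

lemma norm_S_le: "t \<ge> 0 \<Longrightarrow> norm (S t x) \<le> exp (\<beta> * t) * norm x"
  using norm_blinfun[of "S t" x] pseudo_contractive[of t]
  by (meson mult_right_mono norm_ge_zero order_trans)

text \<open>The absolute value makes the bound uniform on \<open>[0, T]\<close> for either sign of
  \<open>\<beta>\<close>.\<close>

lemma norm_S_le_const: "\<lbrakk>t \<ge> 0; t \<le> T\<rbrakk> \<Longrightarrow> norm (S t x) \<le> exp (\<bar>\<beta>\<bar> * T) * norm x"
  by (rule order_trans[OF norm_S_le mult_right_mono]) (auto intro!: mult_mono)

lemma S_near_0: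
  assumes "e > 0"
  obtains d where "d > 0" "\<And>h. \<lbrakk>0 \<le> h; h < d\<rbrakk> \<Longrightarrow> norm (S h x - x) < e"
proof -
  have "((\<lambda>t. S t x) \<longlongrightarrow> x) (at_right 0)"
    using semigroup by (simp add: C0_semigroup_def)
  then obtain d where "d > 0" "\<And>h. \<lbrakk>0 < h; h < d\<rbrakk> \<Longrightarrow> dist (S h x) x < e"
    using assms by (auto dest!: tendstoD simp: eventually_at_right_field)
  then show thesis
    using that[of d] assms S_0 by (metis dist_norm dist_self order_le_less)
qed

text \<open>Since \<open>S t x - S r x = S r (S (t - r) x - x)\<close>, continuity at any time
  reduces to continuity at \<open>0\<close>.\<close>

lemma S_diff_le:
  assumes "0 \<le> r" "r \<le> t" "t \<le> T"
  shows "norm (S t x - S r x) \<le> exp (\<bar>\<beta>\<bar> * T) * norm (S (t - r) x - x)"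
  using S_add[of r "t - r" x] norm_S_le_const[of r T "S (t - r) x - x"] assms
  by (simp add: blinfun.diff_right)

lemma continuous_on_S: "continuous_on {0..} (\<lambda>t. S t x)"
  unfolding continuous_on_iff
proof (intro ballI allI impI)
  fix t e :: real assume t: "t \<in> {0..}" and "e > 0"
  \<comment> \<open>Both \<open>r\<close> and \<open>t\<close> are at most \<open>t + 1\<close> once
    \<open>dist r t < 1\<close>, so one \<open>M\<close> serves on either side of
    \<open>t\<close>.\<close>
  define M where "M = exp (\<bar>\<beta>\<bar> * (t + 1))"
  have "e / M > 0" using \<open>e > 0\<close> by (simp add: M_def)
  then obtain d where d: "d > 0" "\<And>h. \<lbrakk>0 \<le> h; h < d\<rbrakk> \<Longrightarrow> norm (S h x - x) < e / M"
    using S_near_0 by blast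
  have "dist (S r x) (S t x) < e" if r: "r \<in> {0..}" "dist r t < min d 1" for r
  proof -
    have "dist (S r x) (S t x) \<le> M * norm (S \<bar>r - t\<bar> x - x)"
      using S_diff_le[of r t "t + 1" x] S_diff_le[of t r "t + 1" x] r t
      by (cases "r \<le> t") (auto simp: M_def dist_norm norm_minus_commute)
    also have "\<dots> < e"
      using d(2)[of "\<bar>r - t\<bar>"] r by (simp add: M_def dist_real_def field_simps)
    finally show ?thesis .
  qed
  then show "\<exists>d>0. \<forall>r\<in>{0..}. dist r t < d \<longrightarrow> dist (S r x) (S t x) < e"
    using d(1) by (intro exI[of _ "min d 1"]) auto
qed

text \<open>Only strong continuity of \<open>S\<close> is given, so argument and operator vary
  separately: the uniform bound controls \<open>S (t - s) (g s - g r)\<close>, strong continuity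
  controls \<open>S (t - s) (g r)\<close>.\<close>

lemma continuous_on_convolution:
  assumes "continuous_on {0..t} g"
  shows "continuous_on {0..t} (\<lambda>s. S (t - s) (g s))"
  unfolding continuous_on_def
proof
  fix r assume r: "r \<in> {0..t}"
  have g: "(g \<longlongrightarrow> g r) (at r within {0..t})"
    using assms r by (simp add: continuous_on_def)
  have ev: "\<forall>\<^sub>F s in at r within {0..t}. s \<in> {0..t}"
    by (simp add: eventually_at_filter)
  have "((\<lambda>s. S (t - s) (g s - g r)) \<longlongrightarrow> 0) (at r within {0..t})"
  proof (rule Lim_null_comparison)
    show "\<forall>\<^sub>F s in at r within {0..t}. norm (S (t - s) (g s - g r)) \<le> exp (\<bar>\<beta>\<bar> * t) * norm (g s - g r)"
      using ev by eventually_elim (rule norm_S_le_const, auto)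
    show "((\<lambda>s. exp (\<bar>\<beta>\<bar> * t) * norm (g s - g r)) \<longlongrightarrow> 0) (at r within {0..t})"
      using g by (auto intro!: tendsto_eq_intros)
  qed
  moreover have "((\<lambda>s. S (t - s) (g r)) \<longlongrightarrow> S (t - r) (g r)) (at r within {0..t})"
    using r ev by (intro continuous_on_tendsto_compose[OF continuous_on_S] tendsto_intros)
      (auto elim: eventually_mono)
  ultimately have "((\<lambda>s. S (t - s) (g s - g r) + S (t - s) (g r)) \<longlongrightarrow> 0 + S (t - r) (g r)) (at r within {0..t})"
    by (rule tendsto_add)
  then show "((\<lambda>s. S (t - s) (g s)) \<longlongrightarrow> S (t - r) (g r)) (at r within {0..t})"
    by (simp add: blinfun.diff_right)
qed

lemma semiflow_S: "lipschitz_semiflow (\<lambda>t. S t) \<beta>"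
proof
  show "dist (S t x) (S t y) \<le> exp (\<beta> * t) * dist x y" if "t \<ge> 0" for t x y
    using norm_S_le[OF that, of "x - y"] by (simp add: dist_norm blinfun.diff_right)
qed (simp_all add: S_0 S_add continuous_on_S)

text \<open>The terms with \<open>y\<close> cancel; what remains is the difference quotient of the
  semigroup minus \<open>generator S x\<close>.\<close>

lemma generator_expansion:
  assumes "x \<in> generator_domain S"
  shows "((\<lambda>t. (S t x + t *\<^sub>R y - (x + t *\<^sub>R (generator S x + y))) /\<^sub>R t) \<longlongrightarrow> 0) (at_right 0)"
proof -
  obtain z where z: "((\<lambda>h. (S h x - x) /\<^sub>R h) \<longlongrightarrow> z) (at_right 0)"
    using assms by (auto simp: generator_domain_def)
  then have "generator S x = z"
    unfolding generator_def by (intro tendsto_Lim) auto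
  then have "((\<lambda>h. (S h x - x) /\<^sub>R h - generator S x) \<longlongrightarrow> 0) (at_right 0)"
    using LIM_zero[OF z] by simp
  moreover have "\<forall>\<^sub>F t in at_right 0. (S t x - x) /\<^sub>R t - generator S x
      = (S t x + t *\<^sub>R y - (x + t *\<^sub>R (generator S x + y))) /\<^sub>R t"
    using eventually_at_right_less[of 0]
    by eventually_elim (simp add: algebra_simps)
  ultimately show ?thesis by (rule Lim_transform_eventually)
qed

end

section \<open>Mild solutions of the perturbed equation\<close>

locale lipschitz_perturbation = pseudo_contractive_semigroup S \<beta>
  for S :: "real \<Rightarrow> 'a::banach \<Rightarrow>\<^sub>L 'a" and \<beta> :: real +
  fixes \<alpha> :: "'a \<Rightarrow> 'a" and L :: real
  assumes lipschitz: "L-lipschitz_on UNIV \<alpha>"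
begin

lemma norm_\<alpha>_diff_le: "norm (\<alpha> x - \<alpha> y) \<le> L * norm (x - y)"
  using lipschitz_onD[OF lipschitz, of x y] by (simp add: dist_norm)

lemma mild_solution_continuous: "mild_solution S \<alpha> x \<xi> \<Longrightarrow> A \<subseteq> {0..} \<Longrightarrow> continuous_on A \<xi>"
  unfolding mild_solution_def using continuous_on_subset by blast

lemma mild_solution_eq:
  "mild_solution S \<alpha> x \<xi> \<Longrightarrow> t \<ge> 0 \<Longrightarrow> \<xi> t = S t x + integral {0..t} (\<lambda>s. S (t - s) (\<alpha> (\<xi> s)))"
  by (simp add: mild_solution_def)

lemma mild_solution_0: "mild_solution S \<alpha> x \<xi> \<Longrightarrow> \<xi> 0 = x"
  by (simp add: mild_solution_eq S_0)

lemma continuous_on_integrand: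
  assumes "mild_solution S \<alpha> x \<xi>"
  shows "continuous_on {0..t} (\<lambda>s. S (t - s) (\<alpha> (\<xi> s)))"
proof (rule continuous_on_convolution)
  show "continuous_on {0..t} (\<lambda>s. \<alpha> (\<xi> s))"
    using continuous_on_compose2[OF lipschitz_on_continuous_on[OF lipschitz]
        mild_solution_continuous[OF assms]]
    by auto
qed

lemmas integrable_integrand = integrable_continuous_real[OF continuous_on_integrand]

text \<open>Gives the growth bound of the semiflow and, for \<open>x = y\<close>, uniqueness of mild
  solutions.\<close>

lemma mild_solution_dist_le:
  assumes \<xi>: "mild_solution S \<alpha> x \<xi>" and \<eta>: "mild_solution S \<alpha> y \<eta>" and "t \<ge> 0"
  shows "dist (\<xi> t) (\<eta> t) \<le> exp ((\<beta> + L) * t) * dist x y"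
proof -
  \<comment> \<open>The weight absorbs the growth of the semigroup, so that Gronwall applies with
    rate \<open>L\<close> alone.\<close>
  define u where "u s = exp (- \<beta> * s) * norm (\<xi> s - \<eta> s)" for s
  have cont: "continuous_on {0..t} u" for t
    unfolding u_def using mild_solution_continuous[OF \<xi>] mild_solution_continuous[OF \<eta>]
    by (intro continuous_intros) auto
  have "u t \<le> norm (x - y) + L * integral {0..t} u" if "t \<ge> 0" for t
  proof -
    have "\<xi> t - \<eta> t = S t (x - y) + integral {0..t} (\<lambda>s. S (t - s) (\<alpha> (\<xi> s)) - S (t - s) (\<alpha> (\<eta> s)))"
      using \<open>t \<ge> 0\<close> mild_solution_eq[OF \<xi>] mild_solution_eq[OF \<eta>]
      by (simp add: Henstock_Kurzweil_Integration.integral_diff integrable_integrand[OF \<xi>]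
          integrable_integrand[OF \<eta>] blinfun.diff_right)
    also have "norm \<dots> \<le> exp (\<beta> * t) * norm (x - y) + exp (\<beta> * t) * L * integral {0..t} u"
    proof (rule norm_triangle_mono)
      show "norm (S t (x - y)) \<le> exp (\<beta> * t) * norm (x - y)"
        using \<open>t \<ge> 0\<close> by (rule norm_S_le)
      have "norm (integral {0..t} (\<lambda>s. S (t - s) (\<alpha> (\<xi> s)) - S (t - s) (\<alpha> (\<eta> s))))
          \<le> integral {0..t} (\<lambda>s. exp (\<beta> * t) * L * u s)"
      proof (rule Henstock_Kurzweil_Integration.integral_norm_bound_integral)
        fix s assume s: "s \<in> {0..t}"
        have "norm (S (t - s) (\<alpha> (\<xi> s)) - S (t - s) (\<alpha> (\<eta> s)))
            \<le> exp (\<beta> * (t - s)) * norm (\<alpha> (\<xi> s) - \<alpha> (\<eta> s))"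
          using norm_S_le[of "t - s" "\<alpha> (\<xi> s) - \<alpha> (\<eta> s)"] s by (simp add: blinfun.diff_right)
        also have "\<dots> \<le> exp (\<beta> * (t - s)) * (L * norm (\<xi> s - \<eta> s))"
          by (intro mult_left_mono norm_\<alpha>_diff_le) simp
        also have "\<dots> = exp (\<beta> * t) * L * u s"
          by (simp add: u_def right_diff_distrib exp_diff exp_minus field_simps)
        finally show "norm (S (t - s) (\<alpha> (\<xi> s)) - S (t - s) (\<alpha> (\<eta> s))) \<le> exp (\<beta> * t) * L * u s" .
      next
        show "(\<lambda>s. exp (\<beta> * t) * L * u s) integrable_on {0..t}"
          by (intro integrable_continuous_real continuous_intros cont)
      qed (auto intro!: integrable_diff integrable_integrand[OF \<xi>] integrable_integrand[OF \<eta>])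
      then show "norm (integral {0..t} (\<lambda>s. S (t - s) (\<alpha> (\<xi> s)) - S (t - s) (\<alpha> (\<eta> s))))
          \<le> exp (\<beta> * t) * L * integral {0..t} u"
        by simp
    qed
    finally show ?thesis
      by (simp add: u_def[of t] exp_minus field_simps)
  qed
  then have "u t \<le> norm (x - y) * exp (L * t)"
    using \<open>t \<ge> 0\<close> lipschitz_on_nonneg[OF lipschitz] cont by (intro gronwall) auto
  then show ?thesis
    by (simp add: u_def dist_norm exp_minus exp_add distrib_right field_simps)
qed

text \<open>Cut the integral at \<open>r\<close>: from \<open>[0, r]\<close> the factor
  \<open>S t\<close> comes out and rebuilds \<open>S t (\<xi> r)\<close>; the rest is shifted to
  \<open>[0, t]\<close>.\<close>

lemma mild_solution_shift:
  assumes \<xi>: "mild_solution S \<alpha> x \<xi>" and "r \<ge> 0"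
  shows "mild_solution S \<alpha> (\<xi> r) (\<lambda>t. \<xi> (t + r))"
  unfolding mild_solution_def
proof (intro conjI allI impI)
  show "continuous_on {0..} (\<lambda>t. \<xi> (t + r))"
    by (rule continuous_on_compose2[OF mild_solution_continuous[OF \<xi> order_refl]])
      (use \<open>r \<ge> 0\<close> in \<open>auto intro!: continuous_intros\<close>)
  fix t :: real assume "t \<ge> 0"
  let ?f = "\<lambda>s. S (t + r - s) (\<alpha> (\<xi> s))"
  have "\<xi> (t + r) = S (t + r) x + (integral {0..r} ?f + integral {r..t + r} ?f)"
    using mild_solution_eq[OF \<xi>, of "t + r"] \<open>t \<ge> 0\<close> \<open>r \<ge> 0\<close>
    by (simp add: Henstock_Kurzweil_Integration.integral_combine integrable_integrand[OF \<xi>])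
  also have "integral {r..t + r} ?f = integral {0..t} (\<lambda>s. S (t - s) (\<alpha> (\<xi> (s + r))))"
    using integral_shift_Icc_real[of 0 t ?f r] by (simp add: o_def add.commute)
  also have "integral {0..r} ?f = integral {0..r} (\<lambda>s. S t (S (r - s) (\<alpha> (\<xi> s))))"
  proof (rule Henstock_Kurzweil_Integration.integral_cong)
    fix s assume "s \<in> {0..r}"
    then show "?f s = S t (S (r - s) (\<alpha> (\<xi> s)))"
      using S_add[of t "r - s" "\<alpha> (\<xi> s)"] \<open>t \<ge> 0\<close> by (simp add: algebra_simps)
  qed
  also have "\<dots> = S t (integral {0..r} (\<lambda>s. S (r - s) (\<alpha> (\<xi> s))))"
    using integral_linear[OF integrable_integrand[OF \<xi>, of r] blinfun.bounded_linear_right[of "S t"]]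
    by (simp add: o_def)
  finally show "\<xi> (t + r) = S t (\<xi> r) + integral {0..t} (\<lambda>s. S (t - s) (\<alpha> (\<xi> (s + r))))"
    using mild_solution_eq[OF \<xi> \<open>r \<ge> 0\<close>] S_add[OF \<open>t \<ge> 0\<close> \<open>r \<ge> 0\<close>, of x]
    by (simp add: blinfun.add_right algebra_simps)
qed

lemma semiflow_mild_solution:
  assumes mild: "\<And>x. mild_solution S \<alpha> x (\<lambda>t. \<xi> t x)"
  shows "lipschitz_semiflow \<xi> (\<beta> + L)"
proof
  show "\<xi> (s + t) x = \<xi> s (\<xi> t x)" if "s \<ge> 0" "t \<ge> 0" for s t x
    \<comment> \<open>The shifted solution and the one restarted at \<open>\<xi> t x\<close> have
      the same initial value, so their distance is at most \<open>0\<close>.\<close>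
    using mild_solution_dist_le[OF mild_solution_shift[OF mild[of x] that(2)] mild[of "\<xi> t x"] that(1)]
    by simp
qed (use mild in \<open>auto intro: mild_solution_0 mild_solution_dist_le mild_solution_continuous\<close>)

text \<open>The integrand in the mild solution formula is uniformly close to
  \<open>\<alpha> x\<close> on \<open>[0, t]\<close> for small \<open>t\<close>, so its integral is
  \<open>t *\<^sub>R \<alpha> x\<close> up to \<open>o(t)\<close>.\<close>

lemma mild_solution_expansion:
  assumes \<xi>: "mild_solution S \<alpha> x \<xi>"
  shows "((\<lambda>t. (\<xi> t - (S t x + t *\<^sub>R \<alpha> x)) /\<^sub>R t) \<longlongrightarrow> 0) (at_right 0)"
proof (rule tendstoI)
  fix e :: real assume "e > 0"
  \<comment> \<open>The exponential bounds \<open>S\<close> up to time \<open>1\<close>;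
    \<open>L + 1\<close> in place of \<open>L\<close> keeps \<open>M\<close> positive when
    \<open>L = 0\<close>.\<close>
  define M where "M = exp \<bar>\<beta>\<bar> * (L + 1)"
  have "M > 0" using lipschitz_on_nonneg[OF lipschitz] by (simp add: M_def)
  have e': "e / 4 > 0" "e / (4 * M) > 0" using \<open>e > 0\<close> \<open>M > 0\<close> by auto
  obtain d1 where d1: "d1 > 0" "\<And>h. \<lbrakk>0 \<le> h; h < d1\<rbrakk> \<Longrightarrow> norm (S h (\<alpha> x) - \<alpha> x) < e / 4"
    using S_near_0[OF e'(1)] by blast
  obtain d2 where d2: "d2 > 0" "\<And>h. \<lbrakk>0 \<le> h; h < d2\<rbrakk> \<Longrightarrow> norm (\<xi> h - x) < e / (4 * M)"
    using mild_solution_continuous[OF \<xi> order_refl] e'(2) mild_solution_0[OF \<xi>]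
    unfolding continuous_on_iff by (force simp: dist_norm)
  have "dist ((\<xi> t - (S t x + t *\<^sub>R \<alpha> x)) /\<^sub>R t) 0 < e"
    if t: "0 < t" "t < min 1 (min d1 d2)" for t
  proof -
    have "\<xi> t - (S t x + t *\<^sub>R \<alpha> x) = integral {0..t} (\<lambda>s. S (t - s) (\<alpha> (\<xi> s)) - \<alpha> x)"
      using mild_solution_eq[OF \<xi>, of t] t
      by (simp add: Henstock_Kurzweil_Integration.integral_diff[OF integrable_integrand[OF \<xi>] integrable_const_ivl])
    also have "norm \<dots> \<le> integral {0..t} (\<lambda>s. e / 2)"
    proof (rule Henstock_Kurzweil_Integration.integral_norm_bound_integral)
      fix s assume s: "s \<in> {0..t}"
      have "norm (S (t - s) (\<alpha> (\<xi> s) - \<alpha> x)) \<le> exp (\<bar>\<beta>\<bar> * 1) * norm (\<alpha> (\<xi> s) - \<alpha> x)"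
        using s t by (intro norm_S_le_const) auto
      also have "\<dots> \<le> exp (\<bar>\<beta>\<bar> * 1) * (L * norm (\<xi> s - x))"
        by (intro mult_left_mono norm_\<alpha>_diff_le) simp
      also have "\<dots> \<le> M * norm (\<xi> s - x)"
        by (simp add: M_def algebra_simps)
      also have "\<dots> \<le> e / 4"
        using d2(2)[of s] s t \<open>M > 0\<close> by (simp add: field_simps)
      finally have "norm (S (t - s) (\<alpha> (\<xi> s) - \<alpha> x)) \<le> e / 4" .
      moreover have "norm (S (t - s) (\<alpha> x) - \<alpha> x) < e / 4"
        using d1(2)[of "t - s"] s t by simp
      ultimately show "norm (S (t - s) (\<alpha> (\<xi> s)) - \<alpha> x) \<le> e / 2"
        using norm_triangle_ineq[of "S (t - s) (\<alpha> (\<xi> s) - \<alpha> x)" "S (t - s) (\<alpha> x) - \<alpha> x"]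
        by (simp add: blinfun.diff_right)
    qed (auto intro!: integrable_diff integrable_integrand[OF \<xi>])
    also have "\<dots> < e * t" using t \<open>e > 0\<close> by simp
    finally show ?thesis using t by (simp add: norm_divideR_less_iff del: norm_scaleR)
  qed
  then show "\<forall>\<^sub>F t in at_right 0. dist ((\<xi> t - (S t x + t *\<^sub>R \<alpha> x)) /\<^sub>R t) 0 < e"
    unfolding eventually_at_right_field using d1(1) d2(1)
    by (intro exI[of _ "min 1 (min d1 d2)"]) auto
qed

lemma mild_solution_dist_S_le:
  assumes \<xi>: "mild_solution S \<alpha> x \<xi>" and B: "\<And>x. norm (\<alpha> x) \<le> B" and "t \<ge> 0"
  shows "dist (\<xi> t) (S t x) \<le> phi \<beta> t * B"
proof -
  have "norm (integral {0..t} (\<lambda>s. S (t - s) (\<alpha> (\<xi> s)))) \<le> integral {0..t} (\<lambda>s. exp (\<beta> * (t - s)) * B)"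
  proof (rule Henstock_Kurzweil_Integration.integral_norm_bound_integral)
    show "norm (S (t - s) (\<alpha> (\<xi> s))) \<le> exp (\<beta> * (t - s)) * B" if "s \<in> {0..t}" for s
      using norm_S_le[of "t - s" "\<alpha> (\<xi> s)"] that B[of "\<xi> s"]
      by (smt (verit) atLeastAtMost_iff exp_ge_zero mult_left_mono)
  qed (auto intro!: integrable_integrand[OF \<xi>] integrable_continuous_real continuous_intros)
  then show ?thesis
    using mild_solution_eq[OF \<xi> \<open>t \<ge> 0\<close>] by (simp add: phi_def dist_norm)
qed

end

section \<open>The equivalences and the two supplements\<close>

text \<open>On nonnegative times \<open>\<xi>\<close> is determined by \<open>mild\<close>, by
  uniqueness of mild solutions. As \<open>K\<close> is nonempty, \<open>infdist\<close> is the
  infimum of the distances to its points.\<close>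

theorem theorem2p10:
  fixes S :: "real \<Rightarrow> 'a::banach \<Rightarrow>\<^sub>L 'a"
    and \<alpha> :: "'a \<Rightarrow> 'a"
    and K :: "'a set"
    and \<xi> :: "real \<Rightarrow> 'a \<Rightarrow> 'a"
    and \<beta> L \<epsilon> :: real
  assumes semigroup: "C0_semigroup S"
    and pseudo_contractive: "\<And>t. t \<ge> 0 \<Longrightarrow> norm (S t) \<le> exp (\<beta> * t)"
    and lipschitz: "L-lipschitz_on UNIV \<alpha>"
    and K: "K \<noteq> {}" "closed K"
    and mild: "\<And>x. mild_solution S \<alpha> x (\<lambda>t. \<xi> t x)"
    and \<epsilon>: "\<epsilon> \<ge> 0"
  defines "stmt_i \<equiv>
      (\<forall>x\<in>K. Liminf (at_right 0)
          (\<lambda>t. ereal (1 / t * infdist (blinfun_apply (S t) x + t *\<^sub>R \<alpha> x) K)) \<le> ereal \<epsilon>)"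
    and "stmt_ii \<equiv>
      (\<forall>t\<ge>0. \<forall>x. infdist (\<xi> t x) K \<le> exp ((\<beta> + L) * t) * infdist x K + phi (\<beta> + L) t * \<epsilon>)"
    and "stmt_iii \<equiv>
      (\<exists>\<delta>>0. \<forall>t\<in>{0..\<delta>}. \<forall>x\<in>K. infdist (\<xi> t x) K \<le> phi (\<beta> + L) t * \<epsilon>)"
  shows "(stmt_i \<longleftrightarrow> stmt_ii) \<and> (stmt_ii \<longleftrightarrow> stmt_iii)
    \<and> (K \<subseteq> generator_domain S \<longrightarrow>
        (stmt_i \<and> stmt_ii \<and> stmt_iii \<longleftrightarrow>
          (\<forall>x\<in>K. Liminf (at_right 0)
             (\<lambda>t. ereal (1 / t * infdist (x + t *\<^sub>R (generator S x + \<alpha> x)) K)) \<le> ereal \<epsilon>)))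
    \<and> (\<forall>B\<ge>0. stmt_i \<and> stmt_ii \<and> stmt_iii \<longrightarrow> (\<forall>x. norm (\<alpha> x) \<le> B) \<longrightarrow>
        (\<forall>t\<ge>0. \<forall>x. infdist (\<xi> t x) K \<le> exp (\<beta> * t) * infdist x K + phi \<beta> t * (\<epsilon> + 2 * B)))"
proof -
  interpret lipschitz_perturbation S \<beta> \<alpha> L
    by unfold_locales (fact semigroup pseudo_contractive lipschitz)+
  interpret flow: lipschitz_semiflow \<xi> "\<beta> + L"
    using mild by (rule semiflow_mild_solution)
  interpret free: lipschitz_semiflow "\<lambda>t. S t" \<beta>
    by (rule semiflow_S)
  \<comment> \<open>The expansion of mild solutions turns (i) into the tangency hypothesis of
    \<open>flow.infdist_flow_le\<close>.\<close>
  have i_iff_tangent: "stmt_i \<longleftrightarrow>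
      (\<forall>x\<in>K. \<forall>c>\<epsilon>. \<exists>\<^sub>F t in at_right 0. infdist (\<xi> t x) K < c * t)"
    unfolding stmt_i_def Liminf_infdist_transfer[OF mild_solution_expansion[OF mild], symmetric]
      Liminf_divide_le_iff ..
  have i_ii: stmt_ii if stmt_i
    unfolding stmt_ii_def
    using that[unfolded i_iff_tangent] K \<epsilon> by (intro allI impI flow.infdist_flow_le) auto
  have ii_iii: stmt_iii if stmt_ii
  proof -
    have "infdist (\<xi> t x) K \<le> phi (\<beta> + L) t * \<epsilon>" if "t \<ge> 0" "x \<in> K" for t x
      using \<open>stmt_ii\<close> that unfolding stmt_ii_def by (metis add_0 infdist_zero mult_zero_right)
    then show ?thesis unfolding stmt_iii_def by (intro exI[of _ 1]) auto
  qed
  have iii_i: stmt_i if stmt_iii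
    unfolding i_iff_tangent
  proof (intro ballI allI impI)
    fix x c assume "x \<in> K" "c > \<epsilon>"
    obtain \<delta> where "\<delta> > 0" and \<delta>: "\<And>t. t \<in> {0..\<delta>} \<Longrightarrow> infdist (\<xi> t x) K \<le> phi (\<beta> + L) t * \<epsilon>"
      using \<open>stmt_iii\<close> \<open>x \<in> K\<close> unfolding stmt_iii_def by blast
    \<comment> \<open>This yields the bound for all small \<open>t\<close>, more than the frequent
      one that (i) asks for.\<close>
    have "((\<lambda>t. phi (\<beta> + L) t / t * \<epsilon>) \<longlongrightarrow> 1 * \<epsilon>) (at_right 0)"
      by (intro tendsto_intros phi_over_t_tendsto)
    then have "\<forall>\<^sub>F t in at_right 0. phi (\<beta> + L) t / t * \<epsilon> < c"
      using \<open>c > \<epsilon>\<close> by (intro order_tendstoD(2)) auto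
    moreover have "\<forall>\<^sub>F t in at_right 0. t \<in> {0<..<\<delta>}"
      using \<open>\<delta> > 0\<close> by (rule eventually_at_right_real)
    ultimately have "\<forall>\<^sub>F t in at_right 0. infdist (\<xi> t x) K < c * t"
    proof eventually_elim
      case (elim t)
      then show ?case using \<delta>[of t] by (simp add: field_simps)
    qed
    then show "\<exists>\<^sub>F t in at_right 0. infdist (\<xi> t x) K < c * t"
      by (rule eventually_frequently[rotated]) simp
  qed
  have i_generator: "stmt_i \<longleftrightarrow> (\<forall>x\<in>K. Liminf (at_right 0)
      (\<lambda>t. ereal (1 / t * infdist (x + t *\<^sub>R (generator S x + \<alpha> x)) K)) \<le> ereal \<epsilon>)"
    if "K \<subseteq> generator_domain S"
    unfolding stmt_i_def
    using that by (intro ball_cong refl Liminf_infdist_transfer generator_expansion) auto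
  have bounded: "infdist (\<xi> t x) K \<le> exp (\<beta> * t) * infdist x K + phi \<beta> t * (\<epsilon> + 2 * B)"
    if stmt_i "B \<ge> 0" and B: "\<And>x. norm (\<alpha> x) \<le> B" and "t \<ge> 0" for B t x
  proof -
    \<comment> \<open>Leaving out \<open>h *\<^sub>R \<alpha> y\<close> moves the point by at most
      \<open>h * B\<close>, so the rate \<open>c - B > \<epsilon>\<close> from (i) becomes
      \<open>c\<close>.\<close>
    have "\<exists>\<^sub>F h in at_right 0. infdist (S h y) K < c * h" if "y \<in> K" "c > \<epsilon> + B" for y c
    proof -
      have "\<exists>\<^sub>F h in at_right 0. infdist (S h y + h *\<^sub>R \<alpha> y) K < (c - B) * h"
        using \<open>stmt_i\<close> that unfolding stmt_i_def Liminf_divide_le_iff by auto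
      moreover have "\<forall>\<^sub>F h in at_right 0. infdist (S h y + h *\<^sub>R \<alpha> y) K < (c - B) * h
          \<longrightarrow> infdist (S h y) K < c * h"
        using eventually_at_right_less[of 0]
      proof eventually_elim
        case (elim h)
        then have "norm (h *\<^sub>R \<alpha> y) \<le> h * B" using B[of y] by simp
        then show ?case
          using infdist_triangle[of "S h y" K "S h y + h *\<^sub>R \<alpha> y"]
          by (auto simp: dist_norm algebra_simps)
      qed
      ultimately show ?thesis by (rule frequently_rev_mp)
    qed
    then have "infdist (S t x) K \<le> exp (\<beta> * t) * infdist x K + phi \<beta> t * (\<epsilon> + B)"
      using K \<epsilon> \<open>B \<ge> 0\<close> \<open>t \<ge> 0\<close> by (intro free.infdist_flow_le) auto
    \<comment> \<open>The second \<open>B\<close> comes from comparing \<open>\<xi>\<close> with the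
      free evolution \<open>S t x\<close>.\<close>
    then show ?thesis
      using infdist_triangle[of "\<xi> t x" K "S t x"] mild_solution_dist_S_le[OF mild B \<open>t \<ge> 0\<close>, of x]
      by (simp add: algebra_simps)
  qed
  show ?thesis
    using i_ii ii_iii iii_i i_generator bounded by blast
qed

end
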